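(* If $\pi: \mathsf{E} \to \mathsf{C}$ is a discrete opfibration, then so too is the functor $\mathrm{Diag}_{\leftarrow}(\pi): \mathrm{Diag}_{\leftarrow}(\mathsf{E}) \to \mathrm{Diag}_{\leftarrow}(\mathsf{C})$ between categories of diagrams.
   Context: A functor $\pi: \mathsf{E} \to \mathsf{C}$ is a discrete opfibration if, for every morphism $f: x \to y$ in $\mathsf{C}$ and every object $\overline{x} \in \mathsf{E}$ with $\pi(\overline{x}) = x$, there exists a unique morphism $\overline{f}$ in $\mathsf{E}$ with domain $\overline{x}$ such that $\pi(\overline{f}) = f$ (the codomain of $\overline{f}$ is not given but is part of the existence and uniqueness statement). A diagram in a category $\mathsf{C}$ is a functor $D: \mathsf{J} \to \mathsf{C}$ with $\mathsf{J}$ a small category. The category $\mathrm{Diag}_{\leftarrow}(\mathsf{C})$ has as objects the diagrams $(\mathsf{J}, D)$ in $\mathsf{C}$ and as morphisms $(\mathsf{J}, D) \to (\mathsf{J}', D')$ the pairs $(R,\rho)$ consisting of a functor $R: \mathsf{J}' \to \mathsf{J}$ (in the backward direction) and a natural transformation $\rho: D \circ R \Rightarrow D'$. The composite of $(R,\rho): (\mathsf{J},D) \to (\mathsf{J}',D')$ and $(S,\tau): (\mathsf{J}',D') \to (\mathsf{J}'',D'')$ is the functor $R \circ S$ together with the transformation whose component at $j''$ is $\rho_{Sj''}$ followed by $\tau_{j''}$; the identity on $(\mathsf{J},D)$ is $(\mathrm{id}_{\mathsf{J}}, \mathrm{id}_D)$. For a functor $F: \mathsf{C} \to \mathsf{D}$,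 the functor $\mathrm{Diag}_{\leftarrow}(F): \mathrm{Diag}_{\leftarrow}(\mathsf{C}) \to \mathrm{Diag}_{\leftarrow}(\mathsf{D})$ sends $(\mathsf{J}, D)$ to $(\mathsf{J}, F \circ D)$ and $(R,\rho)$ to $(R, F * \rho)$, where $F*\rho$ is the whiskering with components $F(\rho_{j'})$. *)

theory Defs
  imports "HOL-Library.FuncSet"
begin

(* Categories have explicit carriers Ob and Arr, and all their structure maps are
   extensional functions (undefined outside their domain, see PiE).  The same is required of
   functors and natural transformations.  Thus equality in HOL of categories, of functors and
   of transformations is the intended equality, as needed for a strict notion such as
   discrete opfibration. *)

record ('o, 'a) cat =
  Ob :: "'o set"
  Arr :: "'a set"
  Dom :: "'a \<Rightarrow> 'o"
  Cod :: "'a \<Rightarrow> 'o"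
  Idn :: "'o \<Rightarrow> 'a"
  Cmp :: "'a \<Rightarrow> 'a \<Rightarrow> 'a"  (infixl "\<cdot>\<index>" 70)

(* g \<cdot> f is g after f *)
definition composable :: "('o, 'a) cat \<Rightarrow> ('a \<times> 'a) set" where
  "composable C = {(g, f). g \<in> Arr C \<and> f \<in> Arr C \<and> Dom C g = Cod C f}"

locale category =
  fixes C :: "('o, 'a) cat" (structure)
  assumes Dom_PiE: "Dom C \<in> Arr C \<rightarrow>\<^sub>E Ob C"
    and Cod_PiE: "Cod C \<in> Arr C \<rightarrow>\<^sub>E Ob C"
    and Idn_PiE: "Idn C \<in> Ob C \<rightarrow>\<^sub>E Arr C"
    and Cmp_PiE: "(\<lambda>(g, f). g \<cdot> f) \<in> composable C \<rightarrow>\<^sub>E Arr C"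
    and Dom_Idn: "x \<in> Ob C \<Longrightarrow> Dom C (Idn C x) = x"
    and Cod_Idn: "x \<in> Ob C \<Longrightarrow> Cod C (Idn C x) = x"
    and Dom_Cmp: "(g, f) \<in> composable C \<Longrightarrow> Dom C (g \<cdot> f) = Dom C f"
    and Cod_Cmp: "(g, f) \<in> composable C \<Longrightarrow> Cod C (g \<cdot> f) = Cod C g"
    and Cmp_Idn_right: "f \<in> Arr C \<Longrightarrow> f \<cdot> Idn C (Dom C f) = f"
    and Cmp_Idn_left: "f \<in> Arr C \<Longrightarrow> Idn C (Cod C f) \<cdot> f = f"
    and Cmp_assoc: "(h, g) \<in> composable C \<Longrightarrow> (g, f) \<in> composable C \<Longrightarrow>
      (h \<cdot> g) \<cdot> f = h \<cdot> (g \<cdot> f)"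

record ('o, 'a, 'p, 'b) fctr =
  omap :: "'o \<Rightarrow> 'p"
  amap :: "'a \<Rightarrow> 'b"

locale cat_functor = dom: category A + cod: category B
  for A :: "('o, 'a) cat" and B :: "('p, 'b) cat" and F :: "('o, 'a, 'p, 'b) fctr" +
  assumes omap_PiE: "omap F \<in> Ob A \<rightarrow>\<^sub>E Ob B"
    and amap_PiE: "amap F \<in> Arr A \<rightarrow>\<^sub>E Arr B"
    and Dom_amap: "f \<in> Arr A \<Longrightarrow> Dom B (amap F f) = omap F (Dom A f)"
    and Cod_amap: "f \<in> Arr A \<Longrightarrow> Cod B (amap F f) = omap F (Cod A f)"
    and amap_Idn: "x \<in> Ob A \<Longrightarrow> amap F (Idn A x) = Idn B (omap F x)"
    and amap_Cmp: "(g, f) \<in> composable A \<Longrightarrow>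
      amap F (g \<cdot>\<^bsub>A\<^esub> f) = amap F g \<cdot>\<^bsub>B\<^esub> amap F f"

definition id_fctr :: "('o, 'a) cat \<Rightarrow> ('o, 'a, 'o, 'a) fctr" where
  "id_fctr A = \<lparr>omap = (\<lambda>x\<in>Ob A. x), amap = (\<lambda>f\<in>Arr A. f)\<rparr>"

(* A is the domain of F. *)
definition comp_fctr ::
  "('o, 'a) cat \<Rightarrow> ('p, 'b, 'q, 'c) fctr \<Rightarrow> ('o, 'a, 'p, 'b) fctr \<Rightarrow> ('o, 'a, 'q, 'c) fctr" where
  "comp_fctr A G F =
    \<lparr>omap = compose (Ob A) (omap G) (omap F), amap = compose (Arr A) (amap G) (amap F)\<rparr>"

locale nat_trans = source: cat_functor A B F + target: cat_functor A B G
  for A :: "('o, 'a) cat" and B :: "('p, 'b) cat"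
    and F G :: "('o, 'a, 'p, 'b) fctr" and \<tau> :: "'o \<Rightarrow> 'b" +
  assumes component_PiE: "\<tau> \<in> Ob A \<rightarrow>\<^sub>E Arr B"
    and Dom_component: "x \<in> Ob A \<Longrightarrow> Dom B (\<tau> x) = omap F x"
    and Cod_component: "x \<in> Ob A \<Longrightarrow> Cod B (\<tau> x) = omap G x"
    and naturality: "f \<in> Arr A \<Longrightarrow>
      amap G f \<cdot>\<^bsub>B\<^esub> \<tau> (Dom A f) = \<tau> (Cod A f) \<cdot>\<^bsub>B\<^esub> amap F f"

locale discrete_opfibration = cat_functor E C P
  for E :: "('p, 'b) cat" and C :: "('o, 'a) cat" and P :: "('p, 'b, 'o, 'a) fctr" +
  assumes unique_lift: "\<And>f x x'. \<lbrakk>f \<in> Arr C; Dom C f = x; x' \<in> Ob E; omap P x' = x\<rbrakk> \<Longrightarrow>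
      \<exists>!f'. f' \<in> Arr E \<and> Dom E f' = x' \<and> amap P f' = f"

(* The types 'j and 'k of objects and arrows of the index categories play the role of the
   universe of small sets: a small category is a category carried by sets of elements of
   these types, which are arbitrary and independent of the types of the category C. *)

record ('j, 'k, 'o, 'a) diagram =
  shape :: "('j, 'k) cat"
  dgm :: "('j, 'k, 'o, 'a) fctr"

(* A morphism (R, \<rho>) of diagrams, together with its domain and codomain *)
record ('j, 'k, 'o, 'a) diagram_mor =
  src :: "('j, 'k, 'o, 'a) diagram"
  tgt :: "('j, 'k, 'o, 'a) diagram"
  reindex :: "('j, 'k, 'j, 'k) fctr"
  component :: "'j \<Rightarrow> 'a"

definition diagrams :: "('o, 'a) cat \<Rightarrow> ('j, 'k, 'o, 'a) diagram set" where
  "diagrams C = {X. cat_functor (shape X) C (dgm X)}"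

definition diagram_mors :: "('o, 'a) cat \<Rightarrow> ('j, 'k, 'o, 'a) diagram_mor set" where
  "diagram_mors C = {m. src m \<in> diagrams C \<and> tgt m \<in> diagrams C \<and>
     cat_functor (shape (tgt m)) (shape (src m)) (reindex m) \<and>
     nat_trans (shape (tgt m)) C
       (comp_fctr (shape (tgt m)) (dgm (src m)) (reindex m)) (dgm (tgt m)) (component m)}"

definition id_diagram_mor ::
  "('o, 'a) cat \<Rightarrow> ('j, 'k, 'o, 'a) diagram \<Rightarrow> ('j, 'k, 'o, 'a) diagram_mor" where
  "id_diagram_mor C X =
    \<lparr>src = X, tgt = X, reindex = id_fctr (shape X),
     component = (\<lambda>j\<in>Ob (shape X). Idn C (omap (dgm X) j))\<rparr>"

definition comp_diagram_mor ::
  "('o, 'a) cat \<Rightarrow> ('j, 'k, 'o, 'a) diagram_mor \<Rightarrow> ('j, 'k, 'o, 'a) diagram_mor \<Rightarrow>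
    ('j, 'k, 'o, 'a) diagram_mor" where
  "comp_diagram_mor C n m =
    \<lparr>src = src m, tgt = tgt n,
     reindex = comp_fctr (shape (tgt n)) (reindex m) (reindex n),
     component = (\<lambda>j\<in>Ob (shape (tgt n)). component n j \<cdot>\<^bsub>C\<^esub> component m (omap (reindex n) j))\<rparr>"

(* Diag with backward reindexing functors *)
definition Diag ::
  "('o, 'a) cat \<Rightarrow> (('j, 'k, 'o, 'a) diagram, ('j, 'k, 'o, 'a) diagram_mor) cat" where
  "Diag C =
    \<lparr>Ob = diagrams C,
     Arr = diagram_mors C,
     Dom = (\<lambda>m\<in>diagram_mors C. src m),
     Cod = (\<lambda>m\<in>diagram_mors C. tgt m),
     Idn = (\<lambda>X\<in>diagrams C. id_diagram_mor C X),
     Cmp = (\<lambda>n m. if n \<in> diagram_mors C \<and> m \<in> diagram_mors C \<and> src n = tgt m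
                    then comp_diagram_mor C n m else undefined)\<rparr>"

definition map_diagram ::
  "('o, 'a, 'p, 'b) fctr \<Rightarrow> ('j, 'k, 'o, 'a) diagram \<Rightarrow> ('j, 'k, 'p, 'b) diagram" where
  "map_diagram F X = \<lparr>shape = shape X, dgm = comp_fctr (shape X) F (dgm X)\<rparr>"

definition map_diagram_mor ::
  "('o, 'a, 'p, 'b) fctr \<Rightarrow> ('j, 'k, 'o, 'a) diagram_mor \<Rightarrow> ('j, 'k, 'p, 'b) diagram_mor" where
  "map_diagram_mor F m =
    \<lparr>src = map_diagram F (src m), tgt = map_diagram F (tgt m), reindex = reindex m,
     component = (\<lambda>j\<in>Ob (shape (tgt m)). amap F (component m j))\<rparr>"

(* A is the domain of F. *)
definition Diag_fctr ::
  "('o, 'a) cat \<Rightarrow> ('o, 'a, 'p, 'b) fctr \<Rightarrow>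
    (('j, 'k, 'o, 'a) diagram, ('j, 'k, 'o, 'a) diagram_mor,
     ('j, 'k, 'p, 'b) diagram, ('j, 'k, 'p, 'b) diagram_mor) fctr" where
  "Diag_fctr A F =
    \<lparr>omap = (\<lambda>X\<in>diagrams A. map_diagram F X),
     amap = (\<lambda>m\<in>diagram_mors A. map_diagram_mor F m)\<rparr>"

end

theory Submission
  imports Defs
begin

text \<open>
  Given a diagram \<open>D\<close> in \<open>E\<close> and a morphism \<open>(R, \<rho>)\<close> from \<open>P \<circ> D\<close> to \<open>D'\<close>, every component of
  \<open>\<rho>\<close> has a unique lift starting at \<open>D (R j)\<close>.  The codomains of these lifts are forced to be the
  objects of the lifted codomain diagram, and its arrows are the unique lifts of those of \<open>D'\<close>.
  Functoriality and naturality hold because two arrows of \<open>E\<close> with the same domain and the same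
  image in \<open>C\<close> are equal.
\<close>

section \<open>Categories and functors\<close>

lemma composable_iff:
  "(g, f) \<in> composable C \<longleftrightarrow> g \<in> Arr C \<and> f \<in> Arr C \<and> Dom C g = Cod C f"
  by (simp add: composable_def)

lemma (in category) Dom_in_Ob: "f \<in> Arr C \<Longrightarrow> Dom C f \<in> Ob C"
  using Dom_PiE by (rule PiE_mem)

lemma (in category) Cod_in_Ob: "f \<in> Arr C \<Longrightarrow> Cod C f \<in> Ob C"
  using Cod_PiE by (rule PiE_mem)

lemma (in category) Idn_in_Arr: "x \<in> Ob C \<Longrightarrow> Idn C x \<in> Arr C"
  using Idn_PiE by (rule PiE_mem)

lemma (in category) Cmp_in_Arr: "(g, f) \<in> composable C \<Longrightarrow> g \<cdot> f \<in> Arr C"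
  using PiE_mem[OF Cmp_PiE, of "(g, f)"] by simp

lemmas (in category) cat_simps =
  composable_iff Dom_in_Ob Cod_in_Ob Idn_in_Arr Cmp_in_Arr
  Dom_Idn Cod_Idn Dom_Cmp Cod_Cmp

lemma (in cat_functor) omap_in_Ob: "x \<in> Ob A \<Longrightarrow> omap F x \<in> Ob B"
  using omap_PiE by (rule PiE_mem)

lemma (in cat_functor) amap_in_Arr: "f \<in> Arr A \<Longrightarrow> amap F f \<in> Arr B"
  using amap_PiE by (rule PiE_mem)

lemmas (in cat_functor) functor_simps =
  omap_in_Ob amap_in_Arr Dom_amap Cod_amap amap_Idn amap_Cmp

section \<open>Identity and composite functors\<close>

lemma omap_id_fctr: "x \<in> Ob A \<Longrightarrow> omap (id_fctr A) x = x"
  and amap_id_fctr: "f \<in> Arr A \<Longrightarrow> amap (id_fctr A) f = f"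
  by (simp_all add: id_fctr_def)

lemma omap_comp_fctr: "x \<in> Ob A \<Longrightarrow> omap (comp_fctr A G F) x = omap G (omap F x)"
  and amap_comp_fctr: "f \<in> Arr A \<Longrightarrow> amap (comp_fctr A G F) f = amap G (amap F f)"
  by (simp_all add: comp_fctr_def compose_def)

lemmas fctr_simps = omap_id_fctr amap_id_fctr omap_comp_fctr amap_comp_fctr

lemma cat_functor_id: "category A \<Longrightarrow> cat_functor A A (id_fctr A)"
  unfolding cat_functor_def cat_functor_axioms_def
  by (auto simp: id_fctr_def category.cat_simps)

lemma cat_functor_comp:
  assumes "cat_functor A B F" and "cat_functor B C G"
  shows "cat_functor A C (comp_fctr A G F)"
proof -
  interpret F: cat_functor A B F by fact
  interpret G: cat_functor B C G by fact
  show ?thesis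
  proof unfold_locales
    show "omap (comp_fctr A G F) \<in> Ob A \<rightarrow>\<^sub>E Ob C" "amap (comp_fctr A G F) \<in> Arr A \<rightarrow>\<^sub>E Arr C"
      by (auto simp: comp_fctr_def compose_def F.functor_simps G.functor_simps)
  qed (auto simp: fctr_simps F.dom.cat_simps F.cod.cat_simps F.functor_simps G.functor_simps)
qed

text \<open>Functors are extensional, so agreement on the carriers of \<open>A\<close> is equality
  in HOL. The target categories may differ, since only the carriers of \<open>A\<close> enter the
  comparison.\<close>

lemma cat_functor_eqI:
  assumes "cat_functor A B F" and "cat_functor A B' G"
    and "\<And>x. x \<in> Ob A \<Longrightarrow> omap F x = omap G x"
    and "\<And>f. f \<in> Arr A \<Longrightarrow> amap F f = amap G f"
  shows "F = (G :: ('o, 'a, 'p, 'b) fctr)"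
proof -
  have "omap F = omap G"
    using cat_functor.omap_PiE[OF assms(1)] cat_functor.omap_PiE[OF assms(2)] assms(3)
    by (meson PiE_iff extensionalityI)
  moreover have "amap F = amap G"
    using cat_functor.amap_PiE[OF assms(1)] cat_functor.amap_PiE[OF assms(2)] assms(4)
    by (meson PiE_iff extensionalityI)
  ultimately show ?thesis by simp
qed

lemma comp_fctr_id: "cat_functor A B F \<Longrightarrow> comp_fctr A F (id_fctr A) = F"
  by (rule cat_functor_eqI[OF cat_functor_comp])
    (auto simp: fctr_simps intro: cat_functor_id cat_functor.axioms(1))

lemma id_comp_fctr: "cat_functor A B F \<Longrightarrow> comp_fctr A (id_fctr B) F = F"
  by (rule cat_functor_eqI[OF cat_functor_comp])
    (auto simp: fctr_simps cat_functor.functor_simps intro: cat_functor_id cat_functor.axioms(2))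

lemma comp_fctr_assoc:
  assumes "cat_functor A B F" and "cat_functor B C G" and "cat_functor C D H"
  shows "comp_fctr A (comp_fctr B H G) F = comp_fctr A H (comp_fctr A G F)"
  by (rule cat_functor_eqI)
    (use assms in \<open>auto simp: fctr_simps cat_functor.functor_simps intro: cat_functor_comp\<close>)

section \<open>Categories of diagrams\<close>

lemma diagrams_iff: "X \<in> diagrams C \<longleftrightarrow> cat_functor (shape X) C (dgm X)"
  by (simp add: diagrams_def)

text \<open>Reduces membership to pointwise conditions: functoriality of the composite
  \<open>D \<circ> R\<close>, demanded by \<open>nat_trans\<close>, follows from that of its two
  factors.\<close>

lemma diagram_mors_iff:
  "m \<in> diagram_mors C \<longleftrightarrow>
    cat_functor (shape (src m)) C (dgm (src m)) \<and> cat_functor (shape (tgt m)) C (dgm (tgt m)) \<and>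
    cat_functor (shape (tgt m)) (shape (src m)) (reindex m) \<and>
    component m \<in> Ob (shape (tgt m)) \<rightarrow>\<^sub>E Arr C \<and>
    (\<forall>j\<in>Ob (shape (tgt m)).
      Dom C (component m j) = omap (dgm (src m)) (omap (reindex m) j) \<and>
      Cod C (component m j) = omap (dgm (tgt m)) j) \<and>
    (\<forall>f\<in>Arr (shape (tgt m)).
      amap (dgm (tgt m)) f \<cdot>\<^bsub>C\<^esub> component m (Dom (shape (tgt m)) f) =
      component m (Cod (shape (tgt m)) f) \<cdot>\<^bsub>C\<^esub> amap (dgm (src m)) (amap (reindex m) f))"
  by (auto simp: diagram_mors_def diagrams_iff nat_trans_def nat_trans_axioms_def fctr_simps
      intro: cat_functor_comp)

text \<open>Packages membership as a locale, so that one interpretation gives access to both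
  diagrams and to the reindexing functor under the names \<open>src\<close>, \<open>tgt\<close> and
  \<open>reindex\<close>.\<close>

locale diagram_mor =
  fixes C :: "('o, 'a) cat" and m :: "('j, 'k, 'o, 'a) diagram_mor"
  assumes mor: "m \<in> diagram_mors C"

sublocale diagram_mor \<subseteq> src: cat_functor "shape (src m)" C "dgm (src m)"
  using mor by (simp add: diagram_mors_iff)

sublocale diagram_mor \<subseteq> tgt: cat_functor "shape (tgt m)" C "dgm (tgt m)"
  using mor by (simp add: diagram_mors_iff)

sublocale diagram_mor \<subseteq> reindex: cat_functor "shape (tgt m)" "shape (src m)" "reindex m"
  using mor by (simp add: diagram_mors_iff)

context diagram_mor
begin

lemma component_PiE: "component m \<in> Ob (shape (tgt m)) \<rightarrow>\<^sub>E Arr C"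
  using mor by (simp add: diagram_mors_iff)

lemma component_in_Arr: "j \<in> Ob (shape (tgt m)) \<Longrightarrow> component m j \<in> Arr C"
  using component_PiE by (rule PiE_mem)

lemma
  assumes "j \<in> Ob (shape (tgt m))"
  shows Dom_component: "Dom C (component m j) = omap (dgm (src m)) (omap (reindex m) j)"
    and Cod_component: "Cod C (component m j) = omap (dgm (tgt m)) j"
  using mor assms by (simp_all add: diagram_mors_iff)

lemma naturality:
  "f \<in> Arr (shape (tgt m)) \<Longrightarrow>
    amap (dgm (tgt m)) f \<cdot>\<^bsub>C\<^esub> component m (Dom (shape (tgt m)) f) =
    component m (Cod (shape (tgt m)) f) \<cdot>\<^bsub>C\<^esub> amap (dgm (src m)) (amap (reindex m) f)"
  using mor by (simp add: diagram_mors_iff)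

lemmas component_simps = component_in_Arr Dom_component Cod_component

lemmas mor_simps = component_simps src.functor_simps tgt.functor_simps reindex.functor_simps
  src.cod.cat_simps src.dom.cat_simps tgt.dom.cat_simps

end

lemma diagram_mor_eqI:
  assumes "m \<in> diagram_mors C" and "n \<in> diagram_mors C'"
    and "src m = src n" and "tgt m = tgt n" and "reindex m = reindex n"
    and "\<And>j. j \<in> Ob (shape (tgt n)) \<Longrightarrow> component m j = component n j"
  shows "m = (n :: ('j, 'k, 'o, 'a) diagram_mor)"
proof -
  interpret m: diagram_mor C m by unfold_locales fact
  interpret n: diagram_mor C' n by unfold_locales fact
  have "component m = component n"
    using m.component_PiE n.component_PiE assms(6) unfolding assms(4)
    by (meson PiE_iff extensionalityI)
  with assms show ?thesis by simp
qed

section \<open>Identities and composites of diagram morphisms\<close>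

lemma id_diagram_mor_in:
  assumes "X \<in> diagrams C"
  shows "id_diagram_mor C X \<in> diagram_mors C"
proof -
  interpret X: cat_functor "shape X" C "dgm X" using assms by (simp add: diagrams_iff)
  show ?thesis
    unfolding diagram_mors_iff
    by (auto simp: id_diagram_mor_def fctr_simps X.functor_simps X.dom.cat_simps X.cod.cat_simps
        intro: X.cat_functor_axioms cat_functor_id X.dom.category_axioms)
      \<comment> \<open>What remains is naturality of the identity components, where both sides
        collapse by the two unit laws of \<open>C\<close>.\<close>
      (metis X.Cod_amap X.Dom_amap X.amap_in_Arr X.cod.Cmp_Idn_left X.cod.Cmp_Idn_right)
qed

text \<open>Naturality comes from pasting two squares: that of \<open>n\<close> at \<open>f\<close>
  and that of \<open>m\<close> at the reindexed arrow \<open>amap (reindex n) f\<close>.\<close>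

lemma comp_diagram_mor_in:
  assumes "n \<in> diagram_mors C" and "m \<in> diagram_mors C" and st: "src n = tgt m"
  shows "comp_diagram_mor C n m \<in> diagram_mors C"
proof -
  interpret m: diagram_mor C m by unfold_locales fact
  interpret n: diagram_mor C n by unfold_locales fact
  note simps = m.mor_simps n.mor_simps[unfolded st] st fctr_simps
  have nat: "amap (dgm (tgt n)) f \<cdot>\<^bsub>C\<^esub>
      (component n (Dom (shape (tgt n)) f) \<cdot>\<^bsub>C\<^esub>
       component m (omap (reindex n) (Dom (shape (tgt n)) f))) =
    component n (Cod (shape (tgt n)) f) \<cdot>\<^bsub>C\<^esub>
      component m (omap (reindex n) (Cod (shape (tgt n)) f)) \<cdot>\<^bsub>C\<^esub>
      amap (dgm (src m)) (amap (reindex m) (amap (reindex n) f))" (is "?D \<cdot>\<^bsub>C\<^esub> (?n \<cdot>\<^bsub>C\<^esub> ?m) = ?n' \<cdot>\<^bsub>C\<^esub> ?m' \<cdot>\<^bsub>C\<^esub> ?F")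
    if f: "f \<in> Arr (shape (tgt n))" for f
  proof -
    \<comment> \<open>The edge shared by the two squares, an arrow of the middle diagram
      \<open>src n = tgt m\<close>.\<close>
    let ?G = "amap (dgm (tgt m)) (amap (reindex n) f)"
    have "?D \<cdot>\<^bsub>C\<^esub> (?n \<cdot>\<^bsub>C\<^esub> ?m) = ?D \<cdot>\<^bsub>C\<^esub> ?n \<cdot>\<^bsub>C\<^esub> ?m"
      by (rule m.src.cod.Cmp_assoc[symmetric]) (use f in \<open>auto simp: simps\<close>)
    also have "?D \<cdot>\<^bsub>C\<^esub> ?n = ?n' \<cdot>\<^bsub>C\<^esub> ?G"
      using n.naturality[OF f] by (simp add: st)
    also have "?n' \<cdot>\<^bsub>C\<^esub> ?G \<cdot>\<^bsub>C\<^esub> ?m = ?n' \<cdot>\<^bsub>C\<^esub> (?G \<cdot>\<^bsub>C\<^esub> ?m)"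
      by (rule m.src.cod.Cmp_assoc) (use f in \<open>auto simp: simps\<close>)
    also have "?G \<cdot>\<^bsub>C\<^esub> ?m = ?m' \<cdot>\<^bsub>C\<^esub> ?F"
      using m.naturality[of "amap (reindex n) f"] f n.reindex.functor_simps by (simp add: st)
    also have "?n' \<cdot>\<^bsub>C\<^esub> (?m' \<cdot>\<^bsub>C\<^esub> ?F) = ?n' \<cdot>\<^bsub>C\<^esub> ?m' \<cdot>\<^bsub>C\<^esub> ?F"
      by (rule m.src.cod.Cmp_assoc[symmetric]) (use f in \<open>auto simp: simps\<close>)
    finally show ?thesis .
  qed
  have "cat_functor (shape (tgt n)) (shape (tgt m)) (reindex n)"
    using n.reindex.cat_functor_axioms by (simp add: st)
  then show ?thesis
    unfolding diagram_mors_iff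
    by (auto simp: comp_diagram_mor_def simps nat
        intro: cat_functor_comp m.reindex.cat_functor_axioms m.src.cat_functor_axioms
          n.tgt.cat_functor_axioms)
qed

section \<open>Category laws for diagrams\<close>

lemma Diag_simps:
  "Ob (Diag C) = diagrams C"
  "Arr (Diag C) = diagram_mors C"
  "m \<in> diagram_mors C \<Longrightarrow> Dom (Diag C) m = src m"
  "m \<in> diagram_mors C \<Longrightarrow> Cod (Diag C) m = tgt m"
  "X \<in> diagrams C \<Longrightarrow> Idn (Diag C) X = id_diagram_mor C X"
  "n \<in> diagram_mors C \<Longrightarrow> m \<in> diagram_mors C \<Longrightarrow> src n = tgt m \<Longrightarrow>
    n \<cdot>\<^bsub>Diag C\<^esub> m = comp_diagram_mor C n m"
  by (simp_all add: Diag_def)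

lemma diagram_mor_sel:
  "src (id_diagram_mor C X) = X" "tgt (id_diagram_mor C X) = X"
  "src (comp_diagram_mor C n m) = src m" "tgt (comp_diagram_mor C n m) = tgt n"
  "src (map_diagram_mor F m) = map_diagram F (src m)"
  "tgt (map_diagram_mor F m) = map_diagram F (tgt m)"
  "reindex (id_diagram_mor C X) = id_fctr (shape X)"
  "reindex (comp_diagram_mor C n m) = comp_fctr (shape (tgt n)) (reindex m) (reindex n)"
  "reindex (map_diagram_mor F m) = reindex m"
  "j \<in> Ob (shape X) \<Longrightarrow> component (id_diagram_mor C X) j = Idn C (omap (dgm X) j)"
  "j \<in> Ob (shape (tgt n)) \<Longrightarrow> component (comp_diagram_mor C n m) j =
    component n j \<cdot>\<^bsub>C\<^esub> component m (omap (reindex n) j)"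
  "j \<in> Ob (shape (tgt m)) \<Longrightarrow> component (map_diagram_mor F m) j = amap F (component m j)"
  by (simp_all add: id_diagram_mor_def comp_diagram_mor_def map_diagram_mor_def)

lemma src_in_diagrams: "m \<in> diagram_mors C \<Longrightarrow> src m \<in> diagrams C"
  and tgt_in_diagrams: "m \<in> diagram_mors C \<Longrightarrow> tgt m \<in> diagrams C"
  by (simp_all add: diagram_mors_def)

lemma comp_diagram_mor_id:
  assumes "m \<in> diagram_mors C"
  shows "comp_diagram_mor C m (id_diagram_mor C (src m)) = m"
proof -
  interpret m: diagram_mor C m by unfold_locales fact
  show ?thesis
    \<comment> \<open>The flipped rule turns the object of the identity arrow into the domain of a
      component of \<open>m\<close>, the form in which the right unit law of \<open>C\<close>
      applies.\<close>
    by (rule diagram_mor_eqI[OF comp_diagram_mor_in assms])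
      (auto simp: assms diagram_mor_sel id_diagram_mor_in src_in_diagrams
        id_comp_fctr[OF m.reindex.cat_functor_axioms] m.reindex.functor_simps
        simp flip: m.Dom_component
        intro!: m.src.cod.Cmp_Idn_right m.component_in_Arr)
qed

lemma id_comp_diagram_mor:
  assumes "m \<in> diagram_mors C"
  shows "comp_diagram_mor C (id_diagram_mor C (tgt m)) m = m"
proof -
  interpret m: diagram_mor C m by unfold_locales fact
  show ?thesis
    by (rule diagram_mor_eqI[OF comp_diagram_mor_in assms])
      (auto simp: assms diagram_mor_sel id_diagram_mor_in tgt_in_diagrams fctr_simps
        comp_fctr_id[OF m.reindex.cat_functor_axioms] simp flip: m.Cod_component
        intro!: m.src.cod.Cmp_Idn_left m.component_in_Arr)
qed

text \<open>Reindexing functors compose in the reverse order, so associativity of functors is used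
  for \<open>l\<close>, \<open>m\<close>, \<open>n\<close> from left to right; on components it is
  associativity in \<open>C\<close>.\<close>

lemma comp_diagram_mor_assoc:
  assumes "l \<in> diagram_mors C" and "m \<in> diagram_mors C" and "n \<in> diagram_mors C"
    and lm: "src m = tgt l" and mn: "src n = tgt m"
  shows "comp_diagram_mor C (comp_diagram_mor C n m) l =
    comp_diagram_mor C n (comp_diagram_mor C m l)"
proof -
  interpret l: diagram_mor C l by unfold_locales fact
  interpret m: diagram_mor C m by unfold_locales fact
  interpret n: diagram_mor C n by unfold_locales fact
  note simps = l.mor_simps m.mor_simps[unfolded lm] n.mor_simps[unfolded mn] lm mn fctr_simps
  show ?thesis
  proof (rule diagram_mor_eqI)
    show "reindex (comp_diagram_mor C (comp_diagram_mor C n m) l) =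
        reindex (comp_diagram_mor C n (comp_diagram_mor C m l))"
      using comp_fctr_assoc[OF n.reindex.cat_functor_axioms
          m.reindex.cat_functor_axioms[folded mn] l.reindex.cat_functor_axioms[folded lm]]
      by (simp add: diagram_mor_sel mn)
  next
    fix j
    assume "j \<in> Ob (shape (tgt (comp_diagram_mor C n (comp_diagram_mor C m l))))"
    then have "j \<in> Ob (shape (tgt n))"
      by (simp add: diagram_mor_sel)
    then show "component (comp_diagram_mor C (comp_diagram_mor C n m) l) j =
        component (comp_diagram_mor C n (comp_diagram_mor C m l)) j"
      by (auto simp: diagram_mor_sel simps intro!: l.src.cod.Cmp_assoc)
  qed (use assms in \<open>auto simp: diagram_mor_sel intro: comp_diagram_mor_in\<close>)
qed

text \<open>A diagram in \<open>C\<close> carries the fact that \<open>C\<close> is a category. If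
  \<open>C\<close> is not one, there are no diagrams and \<open>Diag C\<close> is the empty
  category.\<close>

lemma category_Diag: "category (Diag C)"
proof
  show "(\<lambda>(g, f). g \<cdot>\<^bsub>Diag C\<^esub> f) \<in> composable (Diag C) \<rightarrow>\<^sub>E Arr (Diag C)"
    by (rule PiE_I) (auto simp: composable_iff Diag_def comp_diagram_mor_in)
qed (auto simp: Diag_simps composable_iff diagram_mor_sel src_in_diagrams tgt_in_diagrams
    id_diagram_mor_in comp_diagram_mor_in comp_diagram_mor_id id_comp_diagram_mor
    comp_diagram_mor_assoc, auto simp: Diag_def src_in_diagrams tgt_in_diagrams id_diagram_mor_in)

section \<open>The functor induced on categories of diagrams\<close>

lemma Diag_fctr_simps:
  "X \<in> diagrams A \<Longrightarrow> omap (Diag_fctr A F) X = map_diagram F X"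
  "m \<in> diagram_mors A \<Longrightarrow> amap (Diag_fctr A F) m = map_diagram_mor F m"
  by (simp_all add: Diag_fctr_def)

lemma map_diagram_sel:
  "shape (map_diagram F X) = shape X"
  "dgm (map_diagram F X) = comp_fctr (shape X) F (dgm X)"
  by (simp_all add: map_diagram_def)

lemma map_diagram_in:
  "cat_functor A B F \<Longrightarrow> X \<in> diagrams A \<Longrightarrow> map_diagram F X \<in> diagrams B"
  by (auto simp: diagrams_iff map_diagram_sel intro: cat_functor_comp)

lemma map_diagram_mor_in:
  assumes "cat_functor A B F" and "m \<in> diagram_mors A"
  shows "map_diagram_mor F m \<in> diagram_mors B"
proof -
  interpret F: cat_functor A B F by fact
  interpret m: diagram_mor A m by unfold_locales fact
  \<comment> \<open>\<open>F\<close> preserves composites, so it maps each naturality square of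
    \<open>m\<close> to a commuting square.\<close>
  have nat: "amap F (amap (dgm (tgt m)) f) \<cdot>\<^bsub>B\<^esub> amap F (component m (Dom (shape (tgt m)) f)) =
      amap F (component m (Cod (shape (tgt m)) f)) \<cdot>\<^bsub>B\<^esub>
      amap F (amap (dgm (src m)) (amap (reindex m) f))"
    if "f \<in> Arr (shape (tgt m))" for f
    using arg_cong[OF m.naturality[OF that], of "amap F"] that
    by (simp add: F.amap_Cmp m.mor_simps)
  show ?thesis
    unfolding diagram_mors_iff
    by (auto simp: map_diagram_mor_def map_diagram_sel fctr_simps m.mor_simps F.functor_simps nat
        intro: cat_functor_comp F.cat_functor_axioms m.src.cat_functor_axioms
          m.tgt.cat_functor_axioms m.reindex.cat_functor_axioms)
qed

lemma map_id_diagram_mor: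
  assumes "cat_functor A B F" and "X \<in> diagrams A"
  shows "map_diagram_mor F (id_diagram_mor A X) = id_diagram_mor B (map_diagram F X)"
  by (rule diagram_mor_eqI[OF map_diagram_mor_in id_diagram_mor_in])
    (use assms in \<open>auto simp: diagram_mor_sel map_diagram_sel fctr_simps diagrams_iff
      cat_functor.functor_simps intro: id_diagram_mor_in cat_functor_comp\<close>)

lemma map_comp_diagram_mor:
  assumes "cat_functor A B F" and "n \<in> diagram_mors A" and "m \<in> diagram_mors A"
    and st: "src n = tgt m"
  shows "map_diagram_mor F (comp_diagram_mor A n m) =
    comp_diagram_mor B (map_diagram_mor F n) (map_diagram_mor F m)"
proof -
  interpret F: cat_functor A B F by fact
  interpret m: diagram_mor A m by unfold_locales fact
  interpret n: diagram_mor A n by unfold_locales fact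
  note simps = m.mor_simps n.mor_simps[unfolded st] st fctr_simps
  show ?thesis
    by (rule diagram_mor_eqI[OF map_diagram_mor_in comp_diagram_mor_in])
      (use assms in \<open>auto simp: diagram_mor_sel map_diagram_sel simps F.amap_Cmp
        intro: comp_diagram_mor_in map_diagram_mor_in\<close>)
qed

lemma cat_functor_Diag:
  assumes "cat_functor A B F"
  shows "cat_functor (Diag A) (Diag B) (Diag_fctr A F)"
proof -
  interpret A: category "Diag A" by (rule category_Diag)
  interpret B: category "Diag B" by (rule category_Diag)
  note maps = map_diagram_in[OF assms] map_diagram_mor_in[OF assms]
  show ?thesis
  proof unfold_locales
    show "omap (Diag_fctr A F) \<in> Ob (Diag A) \<rightarrow>\<^sub>E Ob (Diag B)"
      "amap (Diag_fctr A F) \<in> Arr (Diag A) \<rightarrow>\<^sub>E Arr (Diag B)"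
      by (auto simp: Diag_fctr_def Diag_simps maps)
  qed (auto simp: Diag_simps Diag_fctr_simps composable_iff maps diagram_mor_sel src_in_diagrams
      tgt_in_diagrams id_diagram_mor_in comp_diagram_mor_in map_id_diagram_mor[OF assms]
      map_comp_diagram_mor[OF assms])
qed

section \<open>Lifting along a discrete opfibration\<close>

context discrete_opfibration
begin

text \<open>Both arrows lift \<open>amap P g\<close> from \<open>Dom E g\<close>. Codomains do not
  enter, so equality of codomains can be deduced from it.\<close>

lemma arr_eqI:
  assumes "f \<in> Arr E" and "g \<in> Arr E" and "Dom E f = Dom E g" and "amap P f = amap P g"
  shows "f = g"
  using unique_lift[of "amap P g" _ "Dom E g"] assms
  by (metis Dom_amap amap_in_Arr dom.Dom_in_Ob)

text \<open>The description is meaningful when \<open>x\<close> is an object of \<open>E\<close> and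
  \<open>f\<close> an arrow of \<open>C\<close> with \<open>Dom C f = omap P x\<close>; these are
  the hypotheses of the facts about it.\<close>

definition lift :: "'p \<Rightarrow> 'a \<Rightarrow> 'b" where
  "lift x f = (THE f'. f' \<in> Arr E \<and> Dom E f' = x \<and> amap P f' = f)"

lemma
  assumes "x \<in> Ob E" and "f \<in> Arr C" and "Dom C f = omap P x"
  shows lift_in_Arr: "lift x f \<in> Arr E"
    and Dom_lift: "Dom E (lift x f) = x"
    and amap_lift: "amap P (lift x f) = f"
  using theI'[OF unique_lift[of f _ x]] assms by (simp_all add: lift_def)

lemma omap_Cod_lift:
  assumes "x \<in> Ob E" and "f \<in> Arr C" and "Dom C f = omap P x"
  shows "omap P (Cod E (lift x f)) = Cod C f"
  using Cod_amap[OF lift_in_Arr[OF assms]] amap_lift[OF assms] by simp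

lemmas lift_simps = lift_in_Arr Dom_lift amap_lift omap_Cod_lift

text \<open>Existence half of the lifting property. The lift keeps the shape of the target and the
  reindexing functor of \<open>m\<close>; only the components and the target diagram have to be
  constructed.\<close>

lemma diagram_mor_lift:
  fixes m :: "('j, 'k, 'o, 'a) diagram_mor"
  assumes m: "m \<in> diagram_mors C" and X: "X \<in> diagrams E" and src: "src m = map_diagram P X"
  shows "\<exists>m'\<in>diagram_mors E. src m' = X \<and> map_diagram_mor P m' = m"
proof -
  interpret m: diagram_mor C m by unfold_locales fact
  interpret X: cat_functor "shape X" E "dgm X" using X by (simp add: diagrams_iff)
  define J where "J = shape (tgt m)"
  define r where "r j = lift (omap (dgm X) (omap (reindex m) j)) (component m j)" for j
  \<comment> \<open>An object goes to the endpoint of its lifted component, and an arrow to the lift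
    starting at the endpoint assigned to its domain. The restricted abstractions make
    \<open>D\<close> extensional.\<close>
  define D where "D = \<lparr>omap = (\<lambda>j\<in>Ob J. Cod E (r j)),
    amap = (\<lambda>f\<in>Arr J. lift (Cod E (r (Dom J f))) (amap (dgm (tgt m)) f))\<rparr>"
  define m' where "m' = \<lparr>src = X, tgt = \<lparr>shape = J, dgm = D\<rparr>, reindex = reindex m,
    component = (\<lambda>j\<in>Ob J. r j)\<rparr>"
  interpret T: cat_functor J C "dgm (tgt m)"
    unfolding J_def by (rule m.tgt.cat_functor_axioms)
  interpret R: cat_functor J "shape X" "reindex m"
    using m.reindex.cat_functor_axioms by (simp add: J_def src map_diagram_sel)
  have comp: "component m j \<in> Arr C"
      "Dom C (component m j) = omap P (omap (dgm X) (omap (reindex m) j))"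
      "Cod C (component m j) = omap (dgm (tgt m)) j" if "j \<in> Ob J" for j
    using that m.component_simps[of j] R.omap_in_Ob
    by (simp_all add: J_def src map_diagram_sel fctr_simps)
  have r: "r j \<in> Arr E" "Dom E (r j) = omap (dgm X) (omap (reindex m) j)"
      "amap P (r j) = component m j" "omap P (Cod E (r j)) = omap (dgm (tgt m)) j"
    if "j \<in> Ob J" for j
    unfolding r_def using that comp[of j] by (simp_all add: lift_simps X.functor_simps R.functor_simps)
  note base = T.dom.cat_simps dom.cat_simps cod.cat_simps r comp
    T.functor_simps X.functor_simps R.functor_simps functor_simps
  \<comment> \<open>The lift exists because the endpoint of \<open>r (Dom J f)\<close> lies over the
    domain of \<open>amap (dgm (tgt m)) f\<close>.\<close>
  have Df: "amap D f \<in> Arr E" "Dom E (amap D f) = Cod E (r (Dom J f))"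
      "amap P (amap D f) = amap (dgm (tgt m)) f" if "f \<in> Arr J" for f
    using that by (simp_all add: D_def lift_simps base)
  \<comment> \<open>Both paths start at \<open>omap (dgm X) (omap (reindex m) (Dom J f))\<close>,
    and their images under \<open>P\<close> agree by naturality of \<open>m\<close>.\<close>
  have nat: "amap D f \<cdot>\<^bsub>E\<^esub> r (Dom J f) = r (Cod J f) \<cdot>\<^bsub>E\<^esub> amap (dgm X) (amap (reindex m) f)"
    if f: "f \<in> Arr J" for f
  proof (rule arr_eqI)
    show "amap P (amap D f \<cdot>\<^bsub>E\<^esub> r (Dom J f)) =
        amap P (r (Cod J f) \<cdot>\<^bsub>E\<^esub> amap (dgm X) (amap (reindex m) f))"
      using f m.naturality[of f] R.amap_in_Arr[OF f]
      by (simp add: base Df src map_diagram_sel fctr_simps flip: J_def)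
  qed (use f in \<open>simp_all add: base Df\<close>)
  \<comment> \<open>The codomain of a lift is not prescribed: here it is read off the naturality square.\<close>
  have Cod_Df: "Cod E (amap D f) = Cod E (r (Cod J f))" if "f \<in> Arr J" for f
    using arg_cong[OF nat[OF that], of "Cod E"] that by (simp add: base Df)
  have omap_D: "omap D j = Cod E (r j)" if "j \<in> Ob J" for j
    using that by (simp add: D_def)
  have D: "cat_functor J E D"
  proof
    show "omap D \<in> Ob J \<rightarrow>\<^sub>E Ob E" "amap D \<in> Arr J \<rightarrow>\<^sub>E Arr E"
      using Df(1) by (auto simp: D_def base)
  next
    fix j assume j: "j \<in> Ob J"
    \<comment> \<open>Both arrows start at \<open>Cod E (r j)\<close> and lie over the identity of
      \<open>omap (dgm (tgt m)) j\<close>.\<close>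
    show "amap D (Idn J j) = Idn E (omap D j)"
      by (rule arr_eqI) (use j in \<open>simp_all add: base Df omap_D\<close>)
  next
    fix g f assume gf: "(g, f) \<in> composable J"
    \<comment> \<open>The lift of \<open>g\<close> starts at the endpoint of
      \<open>r (Dom J g)\<close>; that the lift of \<open>f\<close> ends there is exactly
      \<open>Cod_Df\<close>.\<close>
    then have comps: "(amap D g, amap D f) \<in> composable E"
      by (simp add: composable_iff Df Cod_Df)
    show "amap D (g \<cdot>\<^bsub>J\<^esub> f) = amap D g \<cdot>\<^bsub>E\<^esub> amap D f"
      by (rule arr_eqI)
        (use gf comps in \<open>simp_all add: dom.Cmp_in_Arr dom.Dom_Cmp amap_Cmp T.amap_Cmp
            T.dom.Cmp_in_Arr T.dom.Dom_Cmp Df composable_iff\<close>)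
  qed (simp_all add: base Df Cod_Df omap_D)
  have m': "m' \<in> diagram_mors E"
    unfolding diagram_mors_iff
    by (auto simp: m'_def base nat omap_D D X.cat_functor_axioms R.cat_functor_axioms)
  moreover have "map_diagram_mor P m' = m"
  proof (rule diagram_mor_eqI[OF map_diagram_mor_in[OF cat_functor_axioms m'] m])
    \<comment> \<open>By construction \<open>D\<close> lies over the given target diagram, on
      objects and on arrows.\<close>
    have "comp_fctr J P D = dgm (tgt m)"
      by (rule cat_functor_eqI[OF cat_functor_comp[OF D cat_functor_axioms] T.cat_functor_axioms])
        (simp_all add: fctr_simps base Df omap_D)
    then show "tgt (map_diagram_mor P m') = tgt m"
      by (simp add: diagram_mor_sel m'_def map_diagram_def J_def)
  qed (simp_all add: diagram_mor_sel m'_def src base flip: J_def)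
  ultimately show ?thesis
    by (intro bexI[of _ m']) (simp_all add: m'_def)
qed

text \<open>Equal images under \<open>P\<close> share target shape and reindexing functor. Then
  components agree, hence the objects of the target diagrams as their codomains, hence the arrows,
  whose domains now coincide.\<close>

lemma diagram_mor_lift_unique:
  fixes n n' :: "('j, 'k, 'p, 'b) diagram_mor"
  assumes "n \<in> diagram_mors E" and "n' \<in> diagram_mors E" and src: "src n = src n'"
    and eq: "map_diagram_mor P n = map_diagram_mor P n'"
  shows "n = n'"
proof -
  interpret n: diagram_mor E n by unfold_locales fact
  interpret n': diagram_mor E n' by unfold_locales fact
  have shape: "shape (tgt n) = shape (tgt n')"
    and dgm: "comp_fctr (shape (tgt n)) P (dgm (tgt n)) = comp_fctr (shape (tgt n)) P (dgm (tgt n'))"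
    and reindex: "reindex n = reindex n'"
    using eq by (auto simp: map_diagram_mor_def map_diagram_def)
  \<comment> \<open>Equal sources and equal reindexing functors give both components the same
    domain.\<close>
  have comp: "component n j = component n' j" if j: "j \<in> Ob (shape (tgt n'))" for j
  proof (rule arr_eqI)
    show "amap P (component n j) = amap P (component n' j)"
      using arg_cong[OF eq, of "\<lambda>m. component m j"] j by (simp add: diagram_mor_sel shape)
  qed (use j in \<open>simp_all add: n.component_simps n'.component_simps shape src reindex\<close>)
  have omap: "omap (dgm (tgt n)) j = omap (dgm (tgt n')) j" if "j \<in> Ob (shape (tgt n'))" for j
    using that comp n.Cod_component[of j] n'.Cod_component[of j] by (simp add: shape)
  have "dgm (tgt n) = dgm (tgt n')"
  proof (rule cat_functor_eqI[OF _ n'.tgt.cat_functor_axioms omap])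
    show "cat_functor (shape (tgt n')) E (dgm (tgt n))"
      using n.tgt.cat_functor_axioms by (simp add: shape)
    fix f assume f: "f \<in> Arr (shape (tgt n'))"
    show "amap (dgm (tgt n)) f = amap (dgm (tgt n')) f"
    \<comment> \<open>The domains agree by \<open>omap\<close>, the images under \<open>P\<close> by
      the equality \<open>dgm\<close> of composite functors.\<close>
    proof (rule arr_eqI)
      show "amap P (amap (dgm (tgt n)) f) = amap P (amap (dgm (tgt n')) f)"
        using arg_cong[OF dgm, of "\<lambda>F. amap F f"] f by (simp add: fctr_simps shape)
    qed (use f in \<open>simp_all add: n.tgt.functor_simps n'.tgt.functor_simps shape omap
        n'.tgt.dom.cat_simps\<close>)
  qed
  with shape have "tgt n = tgt n'" by simp
  with assms(1,2) src show ?thesis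
    using reindex comp by (rule diagram_mor_eqI)
qed

end

theorem theorem5p2:
  fixes E :: "('p, 'b) cat" and C :: "('o, 'a) cat" and \<pi> :: "('p, 'b, 'o, 'a) fctr"
  assumes "discrete_opfibration E C \<pi>"
  shows "discrete_opfibration
    (Diag E :: (('j, 'k, 'p, 'b) diagram, ('j, 'k, 'p, 'b) diagram_mor) cat)
    (Diag C :: (('j, 'k, 'o, 'a) diagram, ('j, 'k, 'o, 'a) diagram_mor) cat)
    (Diag_fctr E \<pi>)"
proof -
  interpret discrete_opfibration E C \<pi> by fact
  interpret Diag: cat_functor "Diag E :: (('j, 'k, 'p, 'b) diagram, _) cat"
    "Diag C :: (('j, 'k, 'o, 'a) diagram, _) cat" "Diag_fctr E \<pi>"
    by (rule cat_functor_Diag) (rule cat_functor_axioms)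
  show ?thesis
  \<comment> \<open>The interpretation \<open>Diag\<close> discharges the functor axioms, which
    leaves the unique lifting property.\<close>
  proof unfold_locales
    fix m :: "('j, 'k, 'o, 'a) diagram_mor" and Y and X :: "('j, 'k, 'p, 'b) diagram"
    assume "m \<in> Arr (Diag C)" and "Dom (Diag C) m = Y" and "X \<in> Ob (Diag E)"
      and "omap (Diag_fctr E \<pi>) X = Y"
    then have m: "m \<in> diagram_mors C" and X: "X \<in> diagrams E" and src: "src m = map_diagram \<pi> X"
      by (simp_all add: Diag_simps Diag_fctr_simps)
    show "\<exists>!m'. m' \<in> Arr (Diag E) \<and> Dom (Diag E) m' = X \<and> amap (Diag_fctr E \<pi>) m' = m"
    proof (rule ex_ex1I)
      show "\<exists>m'. m' \<in> Arr (Diag E) \<and> Dom (Diag E) m' = X \<and> amap (Diag_fctr E \<pi>) m' = m"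
        using diagram_mor_lift[OF m X src] by (auto simp: Diag_simps Diag_fctr_simps)
    next
      fix n n'
      assume "n \<in> Arr (Diag E) \<and> Dom (Diag E) n = X \<and> amap (Diag_fctr E \<pi>) n = m"
        and "n' \<in> Arr (Diag E) \<and> Dom (Diag E) n' = X \<and> amap (Diag_fctr E \<pi>) n' = m"
      then show "n = n'"
        by (intro diagram_mor_lift_unique) (auto simp: Diag_simps Diag_fctr_simps)
    qed
  qed
qed

end
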